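(* For every fixed $n\ge1$ and $k\ge1$ there exists a polynomial $P$ such that the following holds. Let $\Phi(x,\mathbf y)$ be a quantifier-free Presburger formula in the integer variables $x\in\mathbb Z$, $\mathbf y\in\mathbb Z^n$, and let $S=\{x\in\mathbb Z:\exists\mathbf y\in\mathbb Z^n\ \Phi(x,\mathbf y)\}$. If $|S|\ge P(\ell(\Phi))$, then $S$ contains a non-trivial $k$-term arithmetic progression.
   Context: A quantifier-free Presburger formula is a Boolean combination (using negation, conjunction, disjunction) of atoms of the form $a_1z_1+\dots+a_mz_m\le b$ with integer constants $a_i,b$ and integer variables $z_i$; its length $\ell(\Phi)$ is the total length of all its symbols and constants written in binary. A non-trivial $k$-term arithmetic progression is a set $\{a,a+d,\dots,a+(k-1)d\}$ of integers with $d\ne0$. *)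

theory Defs
  imports Complex_Main "HOL-Library.Log_Nat" "HOL-Computational_Algebra.Polynomial"
begin

text \<open>
  Quantifier-free Presburger formulas; variables are named by natural numbers.
  \<open>Atom [(a\<^sub>1, v\<^sub>1), \<dots>, (a\<^sub>m, v\<^sub>m)] b\<close> stands for
  \<open>a\<^sub>1 z\<^bsub>v\<^sub>1\<^esub> + \<dots> + a\<^sub>m z\<^bsub>v\<^sub>m\<^esub> \<le> b\<close>.
\<close>

datatype qf_presburger =
    Atom "(int \<times> nat) list" int
  | Neg qf_presburger
  | Conj qf_presburger qf_presburger
  | Disj qf_presburger qf_presburger

primrec qf_holds :: "(nat \<Rightarrow> int) \<Rightarrow> qf_presburger \<Rightarrow> bool" where
  "qf_holds z (Atom ts b) \<longleftrightarrow> (\<Sum>(a, v)\<leftarrow>ts. a * z v) \<le> b"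
| "qf_holds z (Neg \<Phi>) \<longleftrightarrow> \<not> qf_holds z \<Phi>"
| "qf_holds z (Conj \<Phi> \<Psi>) \<longleftrightarrow> qf_holds z \<Phi> \<and> qf_holds z \<Psi>"
| "qf_holds z (Disj \<Phi> \<Psi>) \<longleftrightarrow> qf_holds z \<Phi> \<or> qf_holds z \<Psi>"

primrec qf_vars :: "qf_presburger \<Rightarrow> nat set" where
  "qf_vars (Atom ts b) = snd ` set ts"
| "qf_vars (Neg \<Phi>) = qf_vars \<Phi>"
| "qf_vars (Conj \<Phi> \<Psi>) = qf_vars \<Phi> \<union> qf_vars \<Psi>"
| "qf_vars (Disj \<Phi> \<Psi>) = qf_vars \<Phi> \<union> qf_vars \<Psi>"

text \<open>
  Number of symbols of an integer written in binary: the digits of its absolute value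
  (\<open>0\<close> is written with one digit, whereas \<open>bitlen 0 = 0\<close>) and a sign if it is negative.
\<close>

definition binary_length :: "int \<Rightarrow> nat" where
  "binary_length a = max 1 (nat (bitlen \<bar>a\<bar>)) + (if a < 0 then 1 else 0)"

text \<open>
  Constants are charged their binary length; each occurrence of a variable, of \<open>+\<close>, of
  \<open>\<le>\<close> and of a connective is charged as one symbol. Parentheses are not charged; with
  fully parenthesised connectives this changes the length by at most a constant factor.
\<close>

primrec qf_length :: "qf_presburger \<Rightarrow> nat" where
  "qf_length (Atom ts b) =
     (\<Sum>(a, v)\<leftarrow>ts. binary_length a + 1) + (length ts - 1) + 1 + binary_length b"
| "qf_length (Neg \<Phi>) = 1 + qf_length \<Phi>"
| "qf_length (Conj \<Phi> \<Psi>) = qf_length \<Phi> + 1 + qf_length \<Psi>"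
| "qf_length (Disj \<Phi> \<Psi>) = qf_length \<Phi> + 1 + qf_length \<Psi>"

text \<open>
  The set of all \<open>x\<close> such that \<open>\<Phi>(x, y)\<close> holds for some integer vector \<open>y\<close> of length \<open>n\<close>:
  variable \<open>0\<close> is \<open>x\<close> and variables \<open>1, \<dots>, n\<close> are the entries of \<open>y\<close>. It is only meaningful
  if \<open>qf_vars \<Phi> \<subseteq> {0..n}\<close>.
\<close>

definition qf_projection :: "nat \<Rightarrow> qf_presburger \<Rightarrow> int set" where
  "qf_projection n \<Phi> = {x. \<exists>y. length y = n \<and> qf_holds (\<lambda>i. (x # y) ! i) \<Phi>}"

definition nontrivial_AP :: "nat \<Rightarrow> int set \<Rightarrow> bool" where
  "nontrivial_AP k A \<longleftrightarrow> (\<exists>a d. d \<noteq> 0 \<and> A = (\<lambda>i. a + int i * d) ` {0..<k})"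

end

(*
  The atoms of a formula cut space into cells on which its truth value is constant. Cells are convex,
  and m half-spaces in dimension d have at most (m + 1)^d of them: a new half-space splits only
  those cells that meet its bounding hyperplane, which has dimension d - 1. If S is large enough,
  the pigeonhole principle yields two integer points with distinct x that lie in one cell and are
  congruent modulo k in every coordinate. The points dividing the segment between them into k equal
  parts are then integer points of the same cell, and their x-coordinates form the progression.
*)
theory Submission
  imports Defs
begin

section \<open>Counting the cells of a hyperplane arrangement\<close>

text \<open>A point assigns a value to every variable, and \<open>J\<close> lists those that matter.
  Shrinking \<open>J\<close> lowers the dimension while the type of points stays the same, so an
  induction can pass to a hyperplane.\<close>

definition affine_on :: "'v set \<Rightarrow> (('v \<Rightarrow> real) \<Rightarrow> real) \<Rightarrow> bool" where
  "affine_on J f \<longleftrightarrow> (\<exists>a b. \<forall>z. f z = (\<Sum>v\<in>J. a v * z v) + b)"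

text \<open>A cell is encoded by its sign pattern: two points share a cell iff their values agree.
  Points on a bounding hyperplane count to the side \<open>f i z \<le> 0\<close>, as with a
  Presburger atom; the range is the set of nonempty cells.\<close>

definition cell_of :: "'i set \<Rightarrow> ('i \<Rightarrow> ('v \<Rightarrow> real) \<Rightarrow> real) \<Rightarrow> ('v \<Rightarrow> real) \<Rightarrow> 'i set" where
  "cell_of I f z = {i\<in>I. f i z \<le> 0}"

lemma affine_on_const: "affine_on J (\<lambda>z. c)"
  unfolding affine_on_def by (intro exI[of _ "\<lambda>_. 0"] exI[of _ c]) simp

lemma affine_on_var:
  assumes "finite J" "v \<in> J"
  shows "affine_on J (\<lambda>z. z v)"
proof -
  have "(\<Sum>u\<in>J. (if u = v then 1 else 0) * z u) = z v" for z :: "'a \<Rightarrow> real"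
    using assms by (simp add: if_distrib[of "\<lambda>t. t * _"] cong: if_cong)
  then show ?thesis
    unfolding affine_on_def by (intro exI[of _ "\<lambda>u. if u = v then 1 else 0"] exI[of _ 0]) simp
qed

lemma affine_on_add:
  assumes "affine_on J f" "affine_on J g"
  shows "affine_on J (\<lambda>z. f z + g z)"
proof -
  obtain a b a' b' where "\<And>z. f z = (\<Sum>v\<in>J. a v * z v) + b" "\<And>z. g z = (\<Sum>v\<in>J. a' v * z v) + b'"
    using assms unfolding affine_on_def by metis
  then show ?thesis
    unfolding affine_on_def
    by (intro exI[of _ "\<lambda>v. a v + a' v"] exI[of _ "b + b'"]) (simp add: algebra_simps sum.distrib)
qed

lemma affine_on_cmult:
  assumes "affine_on J f"
  shows "affine_on J (\<lambda>z. c * f z)"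
proof -
  obtain a b where "\<And>z. f z = (\<Sum>v\<in>J. a v * z v) + b"
    using assms unfolding affine_on_def by metis
  then show ?thesis
    unfolding affine_on_def
    by (intro exI[of _ "\<lambda>v. c * a v"] exI[of _ "c * b"]) (simp add: algebra_simps sum_distrib_left)
qed

lemma affine_on_sum:
  assumes "\<And>i. i \<in> A \<Longrightarrow> affine_on J (f i)"
  shows "affine_on J (\<lambda>z. \<Sum>i\<in>A. f i z)"
  using assms by (induction A rule: infinite_finite_induct) (auto intro: affine_on_add affine_on_const)

lemma affine_on_sum_list:
  assumes "\<And>t. t \<in> set ts \<Longrightarrow> affine_on J (f t)"
  shows "affine_on J (\<lambda>z. \<Sum>t\<leftarrow>ts. f t z)"
  using assms by (induction ts) (auto intro: affine_on_add affine_on_const)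

text \<open>This restricts \<open>f\<close> to the hyperplane \<open>z j = s z\<close>, parametrised
  by the remaining coordinates.\<close>

lemma affine_on_subst:
  assumes "finite J" "j \<in> J" "affine_on J f" "affine_on (J - {j}) s"
  shows "affine_on (J - {j}) (\<lambda>z. f (z(j := s z)))"
proof -
  obtain a b where f: "\<And>z. f z = (\<Sum>v\<in>J. a v * z v) + b"
    using assms(3) unfolding affine_on_def by metis
  have "f (z(j := s z)) = a j * s z + ((\<Sum>v\<in>J - {j}. a v * z v) + b)" for z
    using assms(1,2) by (simp add: f sum.remove[of J j])
  moreover have "affine_on (J - {j}) (\<lambda>z. a j * s z + ((\<Sum>v\<in>J - {j}. a v * z v) + b))"
    using assms by (intro affine_on_add affine_on_cmult affine_on_sum affine_on_const affine_on_var) auto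
  ultimately show ?thesis by simp
qed

section \<open>Convexity of cells\<close>

lemma affine_on_segment:
  assumes "affine_on J f"
  shows "f (\<lambda>v. (1 - t) * p v + t * q v) = (1 - t) * f p + t * f q"
proof -
  obtain a b where "\<And>z. f z = (\<Sum>v\<in>J. a v * z v) + b"
    using assms unfolding affine_on_def by metis
  moreover have "(\<Sum>v\<in>J. a v * ((1 - t) * p v + t * q v))
      = (1 - t) * (\<Sum>v\<in>J. a v * p v) + t * (\<Sum>v\<in>J. a v * q v)"
    unfolding sum_distrib_left sum.distrib[symmetric] by (intro sum.cong) (simp_all add: algebra_simps)
  ultimately show ?thesis by (simp add: algebra_simps)
qed

lemma convex_combination_sign:
  fixes a b t :: real
  assumes "0 \<le> t" "t \<le> 1" "a \<le> 0 \<longleftrightarrow> b \<le> 0"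
  shows "(1 - t) * a + t * b \<le> 0 \<longleftrightarrow> a \<le> 0"
proof (cases "a \<le> 0")
  case True
  then have "(1 - t) * a \<le> 0" "t * b \<le> 0"
    using assms by (auto simp: mult_nonneg_nonpos)
  then show ?thesis using True by linarith
next
  case False
  then have "a > 0" "b > 0" using assms by auto
  then have "(1 - t) * a + t * b > 0"
    using assms by (cases "t = 0") (auto intro!: add_nonneg_pos)
  then show ?thesis using False by simp
qed

text \<open>Along a segment each \<open>f i\<close> interpolates linearly between its end values.
  These lie on the same side of 0, and both sides are convex.\<close>

lemma cell_of_segment:
  assumes "\<And>i. i \<in> I \<Longrightarrow> affine_on J (f i)" "cell_of I f p = cell_of I f q" "0 \<le> t" "t \<le> 1"
  shows "cell_of I f (\<lambda>v. (1 - t) * p v + t * q v) = cell_of I f p"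
proof -
  have "f i (\<lambda>v. (1 - t) * p v + t * q v) \<le> 0 \<longleftrightarrow> f i p \<le> 0" if "i \<in> I" for i
  proof -
    have "f i p \<le> 0 \<longleftrightarrow> f i q \<le> 0"
      using assms(2) that unfolding cell_of_def by blast
    then show ?thesis
      unfolding affine_on_segment[OF assms(1)[OF that]]
      using convex_combination_sign[OF assms(3,4)] by blast
  qed
  then show ?thesis unfolding cell_of_def by blast
qed

section \<open>Recursion for the number of cells\<close>

lemma finite_range_cell_of: "finite I \<Longrightarrow> finite (range (cell_of I f))"
  by (rule finite_subset[of _ "Pow I"]) (auto simp: cell_of_def)

lemma split_cell_meets_hyperplane:
  assumes "\<And>i. i \<in> I \<Longrightarrow> affine_on J (f i)" "affine_on J h"
    and "cell_of I f p = cell_of I f q" "h p \<le> 0" "h q > 0"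
  obtains z where "cell_of I f z = cell_of I f p" "h z = 0"
proof -
  \<comment> \<open>The root of the linear function \<open>(1 - t) * h p + t * h q\<close>; the
    opposite signs of \<open>h p\<close> and \<open>h q\<close> place it in the unit
    interval.\<close>
  define t where "t = h p / (h p - h q)"
  have t: "0 \<le> t" "t \<le> 1"
    using assms(4,5) by (auto simp: t_def divide_simps)
  have "(1 - t) * h p + t * h q = 0"
    using assms(4,5) by (simp add: t_def divide_simps)
  then show ?thesis
    using that cell_of_segment[OF assms(1,3) t] affine_on_segment[OF assms(2)] by metis
qed

text \<open>Erasing \<open>i0\<close> sends new cells to old ones. An old cell is hit twice only if
  the new hyperplane splits it, and then it meets that hyperplane. The clause with \<open>p\<close>
  makes the last set empty when \<open>f i0\<close> is constant, in particular identically 0, where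
  no cell is split.\<close>

lemma card_range_cell_of_insert_le:
  assumes "finite I" "i0 \<notin> I"
    and "\<And>i. i \<in> insert i0 I \<Longrightarrow> affine_on J (f i)"
  shows "card (range (cell_of (insert i0 I) f))
    \<le> card (range (cell_of I f)) + card (cell_of I f ` {z. f i0 z = 0 \<and> (\<exists>p. f i0 p \<noteq> f i0 z)})"
proof -
  let ?R = "range (cell_of (insert i0 I) f)"
  let ?Q = "cell_of I f ` {z. f i0 z = 0 \<and> (\<exists>p. f i0 p \<noteq> f i0 z)}"
  let ?Out = "{A \<in> ?R. i0 \<notin> A}" and ?In = "{A \<in> ?R. i0 \<in> A}"
  have fin: "finite ?R" "finite (range (cell_of I f))"
    using assms(1) by (simp_all add: finite_range_cell_of)
  have finQ: "finite ?Q"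
    by (rule finite_subset[OF _ fin(2)]) blast
  let ?Red = "(\<lambda>A. A - {i0}) ` ?In"
  have remove: "cell_of (insert i0 I) f z - {i0} = cell_of I f z" for z
    using assms(2) by (auto simp: cell_of_def)
  have "inj_on (\<lambda>A. A - {i0}) ?In"
    by (rule inj_onI) (metis (mono_tags, lifting) insert_Diff mem_Collect_eq)
  then have card1: "card ?Red = card ?In" by (rule card_image)
  have sub: "?Out \<union> ?Red \<subseteq> range (cell_of I f)"
  proof -
    have "A \<in> range (cell_of I f)" if A: "A \<in> ?Out" for A
    proof -
      obtain z where "A = cell_of (insert i0 I) f z" "i0 \<notin> A" using A by blast
      then have "A = cell_of I f z" using remove[of z] by simp
      then show ?thesis by blast
    qed
    moreover have "A - {i0} \<in> range (cell_of I f)" if "A \<in> ?R" for A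
      using that remove by auto
    ultimately show ?thesis by blast
  qed
  \<comment> \<open>A pattern in both sets comes from a cell with points \<open>p\<close> and
    \<open>q\<close> on either side, so convexity gives a point on the hyperplane; \<open>q\<close>
    also witnesses that \<open>f i0\<close> is not constant.\<close>
  have int: "?Out \<inter> ?Red \<subseteq> ?Q"
  proof
    fix A assume A: "A \<in> ?Out \<inter> ?Red"
    then obtain q where q: "A = cell_of (insert i0 I) f q" "i0 \<notin> A" by auto
    obtain p where p: "A = cell_of (insert i0 I) f p - {i0}" "i0 \<in> cell_of (insert i0 I) f p"
      using A by auto
    have hp: "f i0 p \<le> 0" and hq: "f i0 q > 0"
      using p(2) q by (auto simp: cell_of_def)
    have Ap: "A = cell_of I f p" using p(1) remove by simp
    have Aq: "A = cell_of I f q" using q remove[of q] by simp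
    have "cell_of I f p = cell_of I f q" using Ap Aq by simp
    then obtain z where "cell_of I f z = cell_of I f p" "f i0 z = 0"
      using split_cell_meets_hyperplane[of I J f "f i0" p q] assms(3) hp hq by auto
    then show "A \<in> ?Q" using Ap hq by (intro image_eqI[of _ _ z]) (auto intro!: exI[of _ q])
  qed
  have "card ?R = card ?Out + card ?In"
  proof -
    have "finite ?Out" "finite ?In" using fin(1) by simp_all
    then have "card (?Out \<union> ?In) = card ?Out + card ?In" by (intro card_Un_disjoint) blast+
    moreover have "?Out \<union> ?In = ?R" by blast
    ultimately show ?thesis by (simp only:)
  qed
  \<comment> \<open>Inclusion-exclusion: the union counts old cells once, the intersection counts
    the split ones again.\<close>
  also have "\<dots> = card (?Out \<union> ?Red) + card (?Out \<inter> ?Red)"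
    using fin card1 card_Un_Int[of ?Out ?Red] by simp
  also have "\<dots> \<le> card (range (cell_of I f)) + card ?Q"
    using card_mono[OF fin(2) sub] card_mono[OF finQ int] by simp
  finally show ?thesis .
qed

text \<open>Cells meeting the new hyperplane are cells of the restricted arrangement, which has one
  variable fewer. Hence \<open>J\<close> and \<open>f\<close> must vary in the induction on
  \<open>I\<close>.\<close>

lemma card_range_cell_of_le:
  assumes "finite I" "finite J" "\<And>i. i \<in> I \<Longrightarrow> affine_on J (f i)"
  shows "card (range (cell_of I f)) \<le> (card I + 1) ^ card J"
  using assms
proof (induction I arbitrary: J f rule: finite_induct)
  case empty
  then show ?case by (simp add: cell_of_def)
next
  case (insert i0 I)
  let ?Q = "cell_of I f ` {z. f i0 z = 0 \<and> (\<exists>p. f i0 p \<noteq> f i0 z)}"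
  have step: "card (range (cell_of (insert i0 I) f)) \<le> card (range (cell_of I f)) + card ?Q"
    using insert.hyps insert.prems(2) by (rule card_range_cell_of_insert_le)
  have IH: "card (range (cell_of I f)) \<le> (card I + 1) ^ card J"
    using insert by simp
  obtain a b where h: "\<And>z. f i0 z = (\<Sum>v\<in>J. a v * z v) + b"
    using insert.prems(2)[of i0] unfolding affine_on_def by auto
  show ?case
  proof (cases "\<forall>v\<in>J. a v = 0")
    case True
    \<comment> \<open>Here \<open>f i0\<close> is the constant \<open>b\<close>, so the new
      half-space is empty or everything.\<close>
    then have "?Q = {}" by (simp add: h)
    then have "card (range (cell_of (insert i0 I) f)) \<le> (card I + 1) ^ card J"
      using step IH by (simp only: card.empty)
    also have "\<dots> \<le> (card (insert i0 I) + 1) ^ card J"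
      using insert.hyps by (intro power_mono) simp_all
    finally show ?thesis .
  next
    case False
    then obtain j where j: "j \<in> J" "a j \<noteq> 0" by blast
    \<comment> \<open>\<open>s\<close> solves \<open>f i0 z = 0\<close> for the coordinate
      \<open>j\<close>, and \<open>g\<close> is the arrangement restricted to that hyperplane.
      Points already on it are fixed by the substitution, so they keep their cell.\<close>
    define s where "s z = (- 1 / a j) * ((\<Sum>v\<in>J - {j}. a v * z v) + b)" for z
    define g where "g i z = f i (z(j := s z))" for i z
    have s: "affine_on (J - {j}) s"
      unfolding s_def using insert.prems(1)
      by (intro affine_on_cmult affine_on_add affine_on_sum affine_on_const affine_on_var) auto
    have g: "affine_on (J - {j}) (g i)" if "i \<in> I" for i
      unfolding g_def using affine_on_subst[OF insert.prems(1) j(1) insert.prems(2) s] that by blast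
    have "?Q \<subseteq> range (cell_of I g)"
    proof
      fix A assume "A \<in> ?Q"
      then obtain z where z: "A = cell_of I f z" "f i0 z = 0" by auto
      have "s z = z j"
        using z(2) j insert.prems(1) by (simp add: h s_def sum.remove[of J j] field_simps)
      then have "z(j := s z) = z" by simp
      then have "A = cell_of I g z" by (simp add: z(1) cell_of_def g_def)
      then show "A \<in> range (cell_of I g)" by blast
    qed
    then have "card ?Q \<le> card (range (cell_of I g))"
      using insert.hyps by (intro card_mono finite_range_cell_of)
    also have "\<dots> \<le> (card I + 1) ^ card (J - {j})"
      using insert.IH[of "J - {j}" g] insert.prems(1) g by simp
    finally have Q: "card ?Q \<le> (card I + 1) ^ (card J - 1)"
      using j by simp
    obtain d where d: "card J = Suc d"
      using j(1) insert.prems(1) by (metis card_0_eq empty_iff not0_implies_Suc)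
    \<comment> \<open>With m = \<open>card I\<close>, the recursion closes because (m+1)^(d+1) +
      (m+1)^d = (m+2)(m+1)^d \<le> (m+2)^(d+1).\<close>
    have "card (range (cell_of (insert i0 I) f)) \<le> (card I + 1) ^ Suc d + (card I + 1) ^ d"
      using step IH Q by (simp add: d)
    also have "\<dots> = (card I + 2) * (card I + 1) ^ d" by simp
    also have "\<dots> \<le> (card I + 2) * (card I + 2) ^ d"
      by (intro mult_left_mono power_mono) simp_all
    finally show ?thesis using insert.hyps by (simp add: d)
  qed
qed

section \<open>Presburger formulas\<close>

primrec qf_atoms :: "qf_presburger \<Rightarrow> ((int \<times> nat) list \<times> int) set" where
  "qf_atoms (Atom ts b) = {(ts, b)}"
| "qf_atoms (Neg \<Phi>) = qf_atoms \<Phi>"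
| "qf_atoms (Conj \<Phi> \<Psi>) = qf_atoms \<Phi> \<union> qf_atoms \<Psi>"
| "qf_atoms (Disj \<Phi> \<Psi>) = qf_atoms \<Phi> \<union> qf_atoms \<Psi>"

text \<open>Left side minus right side, so that the atom becomes the condition
  \<open>\<le> 0\<close>. Arguments are real because the point where a segment crosses a hyperplane
  need not be integral.\<close>

definition atom_fun :: "(int \<times> nat) list \<times> int \<Rightarrow> (nat \<Rightarrow> real) \<Rightarrow> real" where
  "atom_fun t z = (\<Sum>u\<leftarrow>fst t. of_int (fst u) * z (snd u)) + of_int (- snd t)"

abbreviation formula_cell :: "qf_presburger \<Rightarrow> (nat \<Rightarrow> int) \<Rightarrow> ((int \<times> nat) list \<times> int) set" where
  "formula_cell \<Phi> z \<equiv> cell_of (qf_atoms \<Phi>) atom_fun (\<lambda>v. real_of_int (z v))"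

lemma finite_qf_atoms: "finite (qf_atoms \<Phi>)"
  by (induction \<Phi>) auto

text \<open>Each occurrence of an atom contributes at least its symbol \<open>\<le>\<close> to the
  length.\<close>

lemma card_qf_atoms_le: "card (qf_atoms \<Phi>) \<le> qf_length \<Phi>"
proof (induction \<Phi>)
  case (Conj \<Phi> \<Psi>)
  then show ?case using card_Un_le[of "qf_atoms \<Phi>" "qf_atoms \<Psi>"] by simp
next
  case (Disj \<Phi> \<Psi>)
  then show ?case using card_Un_le[of "qf_atoms \<Phi>" "qf_atoms \<Psi>"] by simp
qed auto

lemma qf_vars_atom: "(ts, b) \<in> qf_atoms \<Phi> \<Longrightarrow> snd ` set ts \<subseteq> qf_vars \<Phi>"
  by (induction \<Phi>) auto

lemma affine_on_atom_fun:
  assumes "t \<in> qf_atoms \<Phi>" "qf_vars \<Phi> \<subseteq> J" "finite J"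
  shows "affine_on J (atom_fun t)"
proof -
  have "snd u \<in> J" if "u \<in> set (fst t)" for u
    using qf_vars_atom[of "fst t" "snd t" \<Phi>] assms that by auto
  then show ?thesis
    unfolding atom_fun_def[abs_def] using assms(3)
    by (intro affine_on_add affine_on_sum_list affine_on_cmult affine_on_var affine_on_const) auto
qed

lemma qf_holds_Atom_iff: "qf_holds z (Atom ts b) \<longleftrightarrow> atom_fun (ts, b) (\<lambda>v. real_of_int (z v)) \<le> 0"
proof -
  have "real_of_int (\<Sum>(a, v)\<leftarrow>ts. a * z v) = (\<Sum>u\<leftarrow>ts. of_int (fst u) * of_int (z (snd u)))"
    by (induction ts) (auto simp: case_prod_unfold)
  then have "atom_fun (ts, b) (\<lambda>v. real_of_int (z v)) = real_of_int ((\<Sum>(a, v)\<leftarrow>ts. a * z v) - b)"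
    by (simp add: atom_fun_def)
  then show ?thesis
    by (simp only: qf_holds.simps of_int_le_0_iff diff_le_0_iff_le)
qed

lemma qf_holds_cong_cell:
  assumes "formula_cell \<Phi> z = formula_cell \<Phi> z'"
  shows "qf_holds z \<Phi> \<longleftrightarrow> qf_holds z' \<Phi>"
proof -
  \<comment> \<open>The cell stays that of the whole formula while the induction runs over formulas
    built from its atoms.\<close>
  have "qf_holds z \<Psi> \<longleftrightarrow> qf_holds z' \<Psi>" if "qf_atoms \<Psi> \<subseteq> qf_atoms \<Phi>" for \<Psi>
    using that
  proof (induction \<Psi>)
    case (Atom ts b)
    then have "(ts, b) \<in> formula_cell \<Phi> z \<longleftrightarrow> qf_holds z (Atom ts b)" for z
      unfolding qf_holds_Atom_iff cell_of_def by auto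
    then show ?case using assms by blast
  qed auto
  then show ?thesis by blast
qed

section \<open>Progressions from two congruent points of one cell\<close>

lemma segment_nontrivial_AP:
  assumes k: "k \<ge> 1" and vars: "qf_vars \<Phi> \<subseteq> {0..n}"
    and len: "length (x # y) = n + 1" "length (x' # y') = n + 1"
    and ne: "x \<noteq> x'"
    and holds: "qf_holds (\<lambda>i. (x # y) ! i) \<Phi>"
    and cell: "formula_cell \<Phi> (\<lambda>i. (x # y) ! i) = formula_cell \<Phi> (\<lambda>i. (x' # y') ! i)"
    and cong: "map (\<lambda>c. c mod int k) (x # y) = map (\<lambda>c. c mod int k) (x' # y')"
  shows "\<exists>A. nontrivial_AP k A \<and> A \<subseteq> qf_projection n \<Phi>"
proof -
  \<comment> \<open>One \<open>k\<close>-th of the difference vector; the congruence modulo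
    \<open>k\<close> makes this division exact in the coordinates up to \<open>n\<close>.\<close>
  define D where "D v = ((x' # y') ! v - (x # y) ! v) div int k" for v
  have D: "int k * D v = (x' # y') ! v - (x # y) ! v" if "v \<le> n" for v
  proof -
    have "map (\<lambda>c. c mod int k) (x # y) ! v = map (\<lambda>c. c mod int k) (x' # y') ! v"
      using cong by simp
    then have "(x # y) ! v mod int k = (x' # y') ! v mod int k"
      using len that by (simp del: list.map)
    then have "int k dvd (x' # y') ! v - (x # y) ! v"
      by (metis mod_eq_dvd_iff)
    then show ?thesis by (simp add: D_def)
  qed
  have D0: "D 0 \<noteq> 0" using D[of 0] ne by auto
  have "x + int i * D 0 \<in> qf_projection n \<Phi>" if i: "i < k" for i
  proof -
    \<comment> \<open>The integer point after \<open>i\<close> steps of \<open>D\<close>; it is also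
      the point at parameter \<open>t = i/k\<close> of the segment, which puts it in the common
      cell.\<close>
    define w where "w = map (\<lambda>v. (x # y) ! v + int i * D v) [0..<n + 1]"
    define t where "t = real i / real k"
    let ?p = "\<lambda>v. real_of_int ((x # y) ! v)" and ?q = "\<lambda>v. real_of_int ((x' # y') ! v)"
    have w0: "w = (x + int i * D 0) # tl w" and lenw: "length (tl w) = n"
      unfolding w_def by (simp_all add: upt_rec[of 0] del: upt_Suc)
    have t: "0 \<le> t" "t \<le> 1" using i by (auto simp: t_def)
    have w: "real_of_int (w ! v) = (1 - t) * ?p v + t * ?q v" if "v \<le> n" for v
    proof -
      have "real k * of_int (D v) = ?q v - ?p v"
        using arg_cong[OF D[OF that], of real_of_int] by simp
      then have "?q v = ?p v + real k * of_int (D v)" by simp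
      moreover have "t * real k = real i" using k by (simp add: t_def)
      moreover have "w ! v = (x # y) ! v + int i * D v"
        using that unfolding w_def by (simp del: upt_Suc)
      ultimately show ?thesis by (simp add: algebra_simps flip: mult.assoc)
    qed
    \<comment> \<open>List lookups beyond index \<open>n\<close> have unspecified values, so
      \<open>w\<close> is compared with the segment only in the coordinates that atoms can
      mention.\<close>
    have restrict: "atom_fun u z = atom_fun u z'"
      if "u \<in> qf_atoms \<Phi>" "\<And>v. v \<le> n \<Longrightarrow> z v = z' v" for u z z'
      using affine_on_atom_fun[OF that(1) vars] that(2) unfolding affine_on_def
      by (metis (no_types, lifting) atLeastAtMost_iff finite_atLeastAtMost sum.cong)
    have "formula_cell \<Phi> (\<lambda>v. w ! v)
        = cell_of (qf_atoms \<Phi>) atom_fun (\<lambda>v. (1 - t) * ?p v + t * ?q v)"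
      unfolding cell_of_def using restrict[OF _ w] by auto
    also have "\<dots> = formula_cell \<Phi> (\<lambda>v. (x # y) ! v)"
      using affine_on_atom_fun[OF _ vars] cell t by (intro cell_of_segment) auto
    finally have "qf_holds (\<lambda>v. w ! v) \<Phi>"
      using qf_holds_cong_cell holds by blast
    then show ?thesis
      unfolding qf_projection_def using w0 lenw by (metis (mono_tags, lifting) mem_Collect_eq)
  qed
  then have "(\<lambda>i. x + int i * D 0) ` {0..<k} \<subseteq> qf_projection n \<Phi>" by auto
  moreover have "nontrivial_AP k ((\<lambda>i. x + int i * D 0) ` {0..<k})"
    unfolding nontrivial_AP_def using D0 by blast
  ultimately show ?thesis by blast
qed

lemma large_projection_nontrivial_AP:
  assumes k: "k \<ge> 1" and vars: "qf_vars \<Phi> \<subseteq> {0..n}"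
    and large: "infinite (qf_projection n \<Phi>) \<or>
      card (qf_projection n \<Phi>) > k ^ (n + 1) * (qf_length \<Phi> + 1) ^ (n + 1)"
  shows "\<exists>A. nontrivial_AP k A \<and> A \<subseteq> qf_projection n \<Phi>"
proof -
  let ?S = "qf_projection n \<Phi>"
  have "\<forall>x\<in>?S. \<exists>y. length y = n \<and> qf_holds (\<lambda>i. (x # y) ! i) \<Phi>"
    unfolding qf_projection_def by blast
  then obtain Y where Y: "\<And>x. x \<in> ?S \<Longrightarrow> length (Y x) = n"
      "\<And>x. x \<in> ?S \<Longrightarrow> qf_holds (\<lambda>i. (x # Y x) ! i) \<Phi>"
    by metis
  \<comment> \<open>The pigeonholes: residues modulo \<open>k\<close> of all \<open>n + 1\<close>
    coordinates, at most \<open>k ^ (n + 1)\<close> choices, paired with the cell of the chosen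
    witness point.\<close>
  define F where "F x = (map (\<lambda>c. c mod int k) (x # Y x), formula_cell \<Phi> (\<lambda>i. (x # Y x) ! i))" for x
  let ?L = "{xs. set xs \<subseteq> {0..<int k} \<and> length xs = n + 1}"
  let ?C = "range (cell_of (qf_atoms \<Phi>) atom_fun)"
  have fin: "finite (?L \<times> ?C)"
    by (intro finite_cartesian_product finite_lists_length_eq finite_range_cell_of finite_qf_atoms) simp
  have img: "F ` ?S \<subseteq> ?L \<times> ?C"
    using k Y(1) by (auto simp: F_def)
  \<comment> \<open>The dimension is \<open>n + 1\<close>, since \<open>x\<close> counts as a
    coordinate beside the entries of \<open>y\<close>.\<close>
  have "card ?C \<le> (card (qf_atoms \<Phi>) + 1) ^ card {0..n}"
    using affine_on_atom_fun[OF _ vars] by (intro card_range_cell_of_le finite_qf_atoms) auto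
  also have "\<dots> \<le> (qf_length \<Phi> + 1) ^ card {0..n}"
    by (intro power_mono add_mono card_qf_atoms_le) simp_all
  finally have cells: "card ?C \<le> (qf_length \<Phi> + 1) ^ (n + 1)" by simp
  have "card (?L \<times> ?C) = k ^ (n + 1) * card ?C"
    unfolding card_cartesian_product by (subst card_lists_length_eq) simp_all
  also have "\<dots> \<le> k ^ (n + 1) * (qf_length \<Phi> + 1) ^ (n + 1)"
    by (intro mult_left_mono cells) simp
  finally have "\<not> inj_on F ?S"
    using large inj_on_finite[OF _ img fin] card_inj_on_le[OF _ img fin] by fastforce
  then obtain x x' where x: "x \<in> ?S" "x' \<in> ?S" "F x = F x'" "x \<noteq> x'"
    unfolding inj_on_def by blast
  then show ?thesis
    using Y by (intro segment_nontrivial_AP[OF k vars, of x "Y x" x' "Y x'"]) (auto simp: F_def)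
qed

theorem theorem9p5:
  fixes n k :: nat
  assumes "n \<ge> 1" and "k \<ge> 1"
  shows "\<exists>P :: real poly. \<forall>\<Phi> :: qf_presburger.
           qf_vars \<Phi> \<subseteq> {0..n} \<longrightarrow>
           (infinite (qf_projection n \<Phi>) \<or>
            real (card (qf_projection n \<Phi>)) \<ge> poly P (real (qf_length \<Phi>))) \<longrightarrow>
           (\<exists>A. nontrivial_AP k A \<and> A \<subseteq> qf_projection n \<Phi>)"
proof -
  \<comment> \<open>The pigeonhole bound plus 1, turning the non-strict hypothesis into the strict
    inequality required.\<close>
  define P :: "real poly" where "P = smult (real (k ^ (n + 1))) ([:1, 1:] ^ (n + 1)) + 1"
  have P: "poly P (real m) = real (k ^ (n + 1) * (m + 1) ^ (n + 1) + 1)" for m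
    by (simp add: P_def poly_power add.commute)
  have "\<exists>A. nontrivial_AP k A \<and> A \<subseteq> qf_projection n \<Phi>"
    if "qf_vars \<Phi> \<subseteq> {0..n}" "infinite (qf_projection n \<Phi>) \<or>
      real (card (qf_projection n \<Phi>)) \<ge> poly P (real (qf_length \<Phi>))" for \<Phi>
    using that large_projection_nontrivial_AP[OF assms(2) that(1)]
    unfolding P of_nat_le_iff by (simp only: Suc_eq_plus1[symmetric] Suc_le_eq)
  then show ?thesis by blast
qed

end
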